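(* Let $K,M:[0,\infty)^2\to[0,\infty)$ be two-variable right-means such that $K(x,y)\le M(x,y)$ for all $x,y\in[0,\infty)$. Assume moreover that $M$ is strict and continuous. For $a,b\in[0,\infty)$ with $a\le b$ set $a_0=a$, $b_0=b$ and, for $n\ge 0$, $$a_{n+1}=K(a_n,b_n),\qquad b_{n+1}=M(a_n,b_n).$$ Then the sequences $(a_n)$ and $(b_n)$ converge to the same limit $d$, and with $N(a,b)=d$ the function $N$ (defined for pairs $0\le a\le b$) is a strict right-mean, i.e. $N(a,b)\le\max\{a,b\}$, with strict inequality when $a\neq b$. If, in addition, $K$ is continuous, then $N$ is upper semi-continuous.
   Context: For $H\subset\mathbb{R}$, a function $K:H^2\to\mathbb{R}$ is a right-mean if $K(x,y)\le\max\{x,y\}$ for all $x,y\in H$. A right-mean is strict if $K(x,y)<\max\{x,y\}$ whenever $x\ne y$. The function $N$ is considered on the set $\{(a,b):0\le a\le b\}$. *)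

theory Defs
  imports "HOL-Analysis.Analysis"
begin

text \<open>The domain \<open>D\<close> is a set of pairs: \<open>H \<times> H\<close> for a mean on \<open>H\<close>, but also a set that is
  not a square, such as the wedge \<open>0 \<le> a \<le> b\<close> below.\<close>

definition right_mean_on :: "(real \<times> real) set \<Rightarrow> (real \<times> real \<Rightarrow> real) \<Rightarrow> bool" where
  "right_mean_on D K \<longleftrightarrow> (\<forall>x y. (x, y) \<in> D \<longrightarrow> K (x, y) \<le> max x y)"

definition strict_right_mean_on :: "(real \<times> real) set \<Rightarrow> (real \<times> real \<Rightarrow> real) \<Rightarrow> bool" where
  "strict_right_mean_on D K \<longleftrightarrow>
     right_mean_on D K \<and> (\<forall>x y. (x, y) \<in> D \<longrightarrow> x \<noteq> y \<longrightarrow> K (x, y) < max x y)"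

text \<open>Semicontinuity relative to the subspace topology of \<open>S\<close>: values of \<open>f\<close> outside \<open>S\<close> are irrelevant.\<close>

definition upper_semicontinuous_on :: "'a::topological_space set \<Rightarrow> ('a \<Rightarrow> real) \<Rightarrow> bool" where
  "upper_semicontinuous_on S f \<longleftrightarrow>
     (\<forall>x\<in>S. \<forall>c. f x < c \<longrightarrow> (\<forall>\<^sub>F y in at x within S. f y < c))"

fun seq_a :: "(real \<times> real \<Rightarrow> real) \<Rightarrow> (real \<times> real \<Rightarrow> real) \<Rightarrow> real \<Rightarrow> real \<Rightarrow> nat \<Rightarrow> real"
and seq_b :: "(real \<times> real \<Rightarrow> real) \<Rightarrow> (real \<times> real \<Rightarrow> real) \<Rightarrow> real \<Rightarrow> real \<Rightarrow> nat \<Rightarrow> real" where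
  "seq_a K M a b 0 = a"
| "seq_a K M a b (Suc n) = K (seq_a K M a b n, seq_b K M a b n)"
| "seq_b K M a b 0 = b"
| "seq_b K M a b (Suc n) = M (seq_a K M a b n, seq_b K M a b n)"

text \<open>Meaningful only where both sequences converge to the same limit.\<close>

definition common_limit ::
    "(real \<times> real \<Rightarrow> real) \<Rightarrow> (real \<times> real \<Rightarrow> real) \<Rightarrow> real \<times> real \<Rightarrow> real" where
  "common_limit K M = (\<lambda>(a, b).
     THE d. seq_a K M a b \<longlonglongrightarrow> d \<and> seq_b K M a b \<longlonglongrightarrow> d)"

definition wedge :: "(real \<times> real) set" where
  "wedge = {(a, b). 0 \<le> a \<and> a \<le> b}"

end

theory Submission
  imports Defs
begin

text \<open>
  Since \<open>K \<le> M\<close>, the iteration maps the wedge \<open>0 \<le> a \<le> b\<close> into itself, and the mean property of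
  \<open>M\<close> makes \<open>b\<^sub>n\<close> decrease; being nonnegative, it converges to some \<open>d\<close>. Every cluster point \<open>l\<close> of the
  bounded sequence \<open>a\<^sub>n\<close> satisfies \<open>l \<le> d\<close>, and passing to the limit in \<open>M (a\<^sub>n, b\<^sub>n) = b\<^bsub>n+1\<^esub>\<close> gives
  \<open>M (l, d) = d = max l d\<close>, which strictness permits only for \<open>l = d\<close>. By compactness
  \<open>a\<^sub>n\<close> converges to \<open>d\<close> as well.

  The remaining claims rest on \<open>N = inf\<^sub>n b\<^sub>n\<close>. Strictness of \<open>N\<close> follows from \<open>N \<le> b\<^sub>1 = M (a, b)\<close>. If \<open>K\<close> is
  continuous, each \<open>b\<^sub>n\<close> is a continuous function of the starting pair, and an infimum of continuous
  functions is upper semicontinuous.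
\<close>

locale strict_mean_iteration =
  fixes K M :: "real \<times> real \<Rightarrow> real"
  assumes K_nonneg: "\<And>x y. 0 \<le> x \<Longrightarrow> 0 \<le> y \<Longrightarrow> 0 \<le> K (x, y)"
    and K_le_M: "\<And>x y. 0 \<le> x \<Longrightarrow> 0 \<le> y \<Longrightarrow> K (x, y) \<le> M (x, y)"
    and strict_M: "strict_right_mean_on ({0..} \<times> {0..}) M"
    and continuous_M: "continuous_on ({0..} \<times> {0..}) M"
begin

lemma M_le_max: "0 \<le> x \<Longrightarrow> 0 \<le> y \<Longrightarrow> M (x, y) \<le> max x y"
  using strict_M by (auto simp: strict_right_mean_on_def right_mean_on_def)

lemma M_less_max: "0 \<le> x \<Longrightarrow> 0 \<le> y \<Longrightarrow> x \<noteq> y \<Longrightarrow> M (x, y) < max x y"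
  using strict_M by (auto simp: strict_right_mean_on_def)

lemma seq_in_wedge:
  assumes "0 \<le> a" "a \<le> b"
  shows "0 \<le> seq_a K M a b n \<and> seq_a K M a b n \<le> seq_b K M a b n"
proof (induction n)
  case 0
  then show ?case using assms by simp
next
  case (Suc n)
  then show ?case using K_nonneg K_le_M by auto
qed

lemma seq_in_quadrant:
  "0 \<le> a \<Longrightarrow> a \<le> b \<Longrightarrow> (seq_a K M a b n, seq_b K M a b n) \<in> {0..} \<times> {0..}"
  using seq_in_wedge[of a b n] by simp

lemma decseq_seq_b:
  assumes "0 \<le> a" "a \<le> b"
  shows "decseq (seq_b K M a b)"
proof (rule decseq_SucI)
  fix n
  show "seq_b K M a b (Suc n) \<le> seq_b K M a b n"
    using seq_in_wedge[OF assms, of n]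
      M_le_max[of "seq_a K M a b n" "seq_b K M a b n"] by simp
qed

text \<open>If \<open>l < d\<close>, then near the pair \<open>(l, d)\<close> one step of the iteration would push the second sequence
  close to \<open>M (l, d)\<close>, hence strictly below \<open>d\<close>, although it also converges to \<open>d\<close>.\<close>

lemma cluster_point_seq_a_eq:
  assumes ab: "0 \<le> a" "a \<le> b"
    and b_lim: "seq_b K M a b \<longlonglongrightarrow> d"
    and r: "strict_mono r"
    and a_lim: "(\<lambda>n. seq_a K M a b (r n)) \<longlonglongrightarrow> l"
  shows "l = d"
proof (rule ccontr)
  assume "l \<noteq> d"
  have b_sub: "(\<lambda>n. seq_b K M a b (r n)) \<longlonglongrightarrow> d"
    using LIMSEQ_subseq_LIMSEQ[OF b_lim r] by (simp add: o_def)
  have "(\<lambda>n. seq_b K M a b (Suc (r n))) \<longlonglongrightarrow> d"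
    using LIMSEQ_subseq_LIMSEQ[OF LIMSEQ_Suc[OF b_lim] r] by (simp add: o_def)
  then have M_lim_d: "(\<lambda>n. M (seq_a K M a b (r n), seq_b K M a b (r n))) \<longlonglongrightarrow> d"
    by simp
  have "0 \<le> l"
    using a_lim seq_in_wedge[OF ab] by (blast intro: LIMSEQ_le_const)
  have "l \<le> d"
    using a_lim b_sub seq_in_wedge[OF ab] by (blast intro: LIMSEQ_le)
  have "(\<lambda>n. M (seq_a K M a b (r n), seq_b K M a b (r n))) \<longlonglongrightarrow> M (l, d)"
    \<comment> \<open>The continuity of \<open>M\<close> is only relative to the quadrant, so membership of the limit matters.\<close>
  proof (rule continuous_on_tendsto_compose[OF continuous_M])
    show "(\<lambda>n. (seq_a K M a b (r n), seq_b K M a b (r n))) \<longlonglongrightarrow> (l, d)"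
      using a_lim b_sub by (rule tendsto_Pair)
    show "(l, d) \<in> {0..} \<times> {0..}"
      using \<open>0 \<le> l\<close> \<open>l \<le> d\<close> by simp
    show "\<forall>\<^sub>F n in sequentially.
        (seq_a K M a b (r n), seq_b K M a b (r n)) \<in> {0..} \<times> {0..}"
      using seq_in_quadrant[OF ab] by (intro always_eventually allI)
  qed
  then have "M (l, d) = d"
    using M_lim_d LIMSEQ_unique by blast
  then show False
    using M_less_max[of l d] \<open>0 \<le> l\<close> \<open>l \<le> d\<close> \<open>l \<noteq> d\<close> by simp
qed

text \<open>If \<open>a\<^sub>n\<close> stayed at distance \<open>e\<close> from \<open>d\<close> along a subsequence, compactness of \<open>[0, b]\<close> would
  give that subsequence a cluster point, which can only be \<open>d\<close>.\<close>

lemma seq_a_tendsto: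
  assumes ab: "0 \<le> a" "a \<le> b" and b_lim: "seq_b K M a b \<longlonglongrightarrow> d"
  shows "seq_a K M a b \<longlonglongrightarrow> d"
proof (rule tendstoI, rule ccontr)
  fix e :: real
  assume "0 < e" and "\<not> (\<forall>\<^sub>F n in sequentially. dist (seq_a K M a b n) d < e)"
  then obtain r :: "nat \<Rightarrow> nat" where r: "strict_mono r"
    and far: "\<And>n. e \<le> dist (seq_a K M a b (r n)) d"
    using not_eventually_sequentiallyD[of "\<lambda>n. dist (seq_a K M a b n) d < e"]
    by (auto simp: not_less)
  have "seq_a K M a b (r n) \<in> {0..b}" for n
    using seq_in_wedge[OF ab, of "r n"] decseqD[OF decseq_seq_b[OF ab], of 0 "r n"] by simp
  then obtain l s where s: "strict_mono s"
    and l: "(\<lambda>n. seq_a K M a b (r (s n))) \<longlonglongrightarrow> l"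
    using seq_compactE[OF compact_imp_seq_compact[OF compact_Icc[of 0 b]],
        of "\<lambda>n. seq_a K M a b (r n)"]
    unfolding o_def by blast
  have "l = d"
    using cluster_point_seq_a_eq[OF ab b_lim strict_mono_o[OF r s]] l by (simp add: o_def)
  then have "\<forall>\<^sub>F n in sequentially. dist (seq_a K M a b (r (s n))) d < e"
    using tendstoD[OF l \<open>0 < e\<close>] by simp
  then obtain n where "dist (seq_a K M a b (r (s n))) d < e"
    by (auto simp: eventually_sequentially)
  then show False
    using far[of "s n"] by simp
qed

lemma tendsto_common_limit:
  assumes ab: "0 \<le> a" "a \<le> b"
  shows "seq_a K M a b \<longlonglongrightarrow> common_limit K M (a, b)"
    and "seq_b K M a b \<longlonglongrightarrow> common_limit K M (a, b)"
proof -
  have "\<And>n. 0 \<le> seq_b K M a b n"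
    using seq_in_quadrant[OF ab] by simp
  then obtain d where b_lim: "seq_b K M a b \<longlonglongrightarrow> d"
    using decseq_convergent[OF decseq_seq_b[OF ab]] by blast
  have a_lim: "seq_a K M a b \<longlonglongrightarrow> d"
    using ab b_lim by (rule seq_a_tendsto)
  have "common_limit K M (a, b) = d"
    unfolding common_limit_def
    using a_lim b_lim by (auto intro: LIMSEQ_unique)
  then show "seq_a K M a b \<longlonglongrightarrow> common_limit K M (a, b)"
    and "seq_b K M a b \<longlonglongrightarrow> common_limit K M (a, b)"
    using a_lim b_lim by simp_all
qed

lemma common_limit_le_seq_b:
  "0 \<le> a \<Longrightarrow> a \<le> b \<Longrightarrow> common_limit K M (a, b) \<le> seq_b K M a b n"
  using decseq_ge decseq_seq_b tendsto_common_limit(2) by blast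

lemma strict_right_mean_common_limit: "strict_right_mean_on wedge (common_limit K M)"
proof -
  have le_M: "common_limit K M (a, b) \<le> M (a, b)" if "0 \<le> a" "a \<le> b" for a b
    using common_limit_le_seq_b[OF that, of 1] by simp
  show ?thesis
    unfolding strict_right_mean_on_def right_mean_on_def
  proof (intro conjI allI impI)
    fix a b
    assume "(a, b) \<in> wedge"
    then have ab: "0 \<le> a" "a \<le> b" "0 \<le> b"
      by (simp_all add: wedge_def)
    show "common_limit K M (a, b) \<le> max a b"
      using le_M[OF ab(1,2)] M_le_max[OF ab(1,3)] by linarith
    show "common_limit K M (a, b) < max a b" if "a \<noteq> b"
      using le_M[OF ab(1,2)] M_less_max[OF ab(1,3) that] by linarith
  qed
qed

lemma continuous_on_seq:
  assumes K: "continuous_on ({0..} \<times> {0..}) K"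
  shows "continuous_on wedge (\<lambda>(a, b). seq_a K M a b n)
       \<and> continuous_on wedge (\<lambda>(a, b). seq_b K M a b n)"
proof (induction n)
  case 0
  then show ?case by (simp add: case_prod_beta continuous_intros)
next
  case (Suc n)
  let ?f = "\<lambda>p. (seq_a K M (fst p) (snd p) n, seq_b K M (fst p) (snd p) n)"
  have f: "continuous_on wedge ?f"
    using Suc by (auto simp: case_prod_beta intro: continuous_on_Pair)
  have image: "?f ` wedge \<subseteq> {0..} \<times> {0..}"
  proof (rule image_subsetI)
    fix p
    assume "p \<in> wedge"
    then show "?f p \<in> {0..} \<times> {0..}"
      unfolding wedge_def by (intro seq_in_quadrant) auto
  qed
  show ?case
    using continuous_on_compose2[OF K f image] continuous_on_compose2[OF continuous_M f image]
    by (simp add: case_prod_beta)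
qed

text \<open>Some \<open>b\<^sub>n\<close> is already below \<open>c\<close> at \<open>p\<close>, hence on a whole neighbourhood of \<open>p\<close> in the wedge, where it
  bounds the common limit from above.\<close>

lemma upper_semicontinuous_common_limit:
  assumes "continuous_on ({0..} \<times> {0..}) K"
  shows "upper_semicontinuous_on wedge (common_limit K M)"
  unfolding upper_semicontinuous_on_def
proof (intro ballI allI impI)
  fix p c
  assume p: "p \<in> wedge" and less: "common_limit K M p < c"
  have "(\<lambda>n. seq_b K M (fst p) (snd p) n) \<longlonglongrightarrow> common_limit K M p"
    using p tendsto_common_limit(2) by (auto simp: wedge_def)
  then obtain n where n: "seq_b K M (fst p) (snd p) n < c"
    using order_tendstoD(2)[OF _ less] by (force simp: eventually_sequentially)
  have "((\<lambda>q. seq_b K M (fst q) (snd q) n) \<longlongrightarrow> seq_b K M (fst p) (snd p) n) (at p within wedge)"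
    using continuous_on_seq[OF assms, of n] p by (simp add: continuous_on_def case_prod_beta)
  then have "\<forall>\<^sub>F q in at p within wedge. seq_b K M (fst q) (snd q) n < c"
    using n by (rule order_tendstoD(2))
  moreover have "\<forall>\<^sub>F q in at p within wedge. q \<in> wedge"
    by (simp add: eventually_at_filter)
  ultimately show "\<forall>\<^sub>F q in at p within wedge. common_limit K M q < c"
  proof eventually_elim
    case (elim q)
    then show ?case
      using common_limit_le_seq_b[of "fst q" "snd q" n] by (auto simp: wedge_def)
  qed
qed

end

theorem theorem5p2:
  fixes K M :: "real \<times> real \<Rightarrow> real"
  assumes "K \<in> {0..} \<times> {0..} \<rightarrow> {0..}" and "M \<in> {0..} \<times> {0..} \<rightarrow> {0..}"
    and "right_mean_on ({0..} \<times> {0..}) K" and "right_mean_on ({0..} \<times> {0..}) M"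
    and "\<And>x y. 0 \<le> x \<Longrightarrow> 0 \<le> y \<Longrightarrow> K (x, y) \<le> M (x, y)"
    and "strict_right_mean_on ({0..} \<times> {0..}) M"
    and "continuous_on ({0..} \<times> {0..}) M"
  shows "(\<forall>a b. 0 \<le> a \<longrightarrow> a \<le> b \<longrightarrow>
            (\<exists>d. seq_a K M a b \<longlonglongrightarrow> d \<and> seq_b K M a b \<longlonglongrightarrow> d \<and> common_limit K M (a, b) = d))
       \<and> strict_right_mean_on wedge (common_limit K M)
       \<and> (continuous_on ({0..} \<times> {0..}) K \<longrightarrow> upper_semicontinuous_on wedge (common_limit K M))"
proof -
  interpret strict_mean_iteration K M
    using assms by unfold_locales auto
  show ?thesis
    using tendsto_common_limit strict_right_mean_common_limit upper_semicontinuous_common_limit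
    by blast
qed

end
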